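(* For all integers $n,p\ge0$, \[ B_{n,\lambda}^{(p)}(x)=\sum_{k=0}^{n}\frac{1}{\binom{k+p}{p}}\,S_{2,\lambda}(n,k\,|\,x). \]
   Context: Let $\lambda\in\mathbb{R}$. Set $(x)_{0,\lambda}=1$, $(x)_{n,\lambda}=x(x-\lambda)\cdots(x-(n-1)\lambda)$ for $n\ge1$; $(y)_0=1$, $(y)_n=y(y-1)\cdots(y-n+1)$. The degenerate exponential is the formal power series $e_\lambda^x(t)=\sum_{n\ge0}(x)_{n,\lambda}\frac{t^n}{n!}$ ($=(1+\lambda t)^{x/\lambda}$, and $e^{xt}$ if $\lambda=0$), $e_\lambda(t)=e_\lambda^1(t)$. The degenerate Stirling polynomials of the second kind $S_{2,\lambda}(n,k\,|\,x)$ are defined by $(y+x)_{n,\lambda}=\sum_{k=0}^n S_{2,\lambda}(n,k\,|\,x)(y)_k$ for all $y$. For an integer $p\ge0$, the truncated degenerate modified Bell polynomials $B^{(p)}_{n,\lambda}(x)$ are defined by \[\frac{p!}{(e_\lambda(t)-1)^p}\Big(e^{e_\lambda(t)-1}-\sum_{l=0}^{p-1}\frac{(e_\lambda(t)-1)^l}{l!}\Big)e_\lambda^x(t)=\sum_{n\ge0}B^{(p)}_{n,\lambda}(x)\frac{t^n}{n!},\] where the left side is, as a formal power series, $p!\sum_{k\ge0}\frac{(e_\lambda(t)-1)^k}{(k+p)!}e_\lambda^x(t)$. *)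

theory Defs
  imports "HOL-Computational_Algebra.Formal_Power_Series"
begin

definition falling_fact :: "real \<Rightarrow> nat \<Rightarrow> real"
  where "falling_fact y n = (\<Prod>i<n. y - real i)"

definition deg_falling_fact :: "real \<Rightarrow> real \<Rightarrow> nat \<Rightarrow> real"
  where "deg_falling_fact lambda x n = (\<Prod>i<n. x - real i * lambda)"

definition deg_exp :: "real \<Rightarrow> real \<Rightarrow> real fps"
  where "deg_exp lambda x = Abs_fps (\<lambda>n. deg_falling_fact lambda x n / fact n)"

text \<open>
  The degenerate Stirling polynomials \<open>S\<^sub>2(n, k | x)\<close> are the coefficients of the shifted degenerate
  falling factorial in the basis of ordinary falling factorials. The clause \<open>\<forall>k>n. c k = 0\<close> only
  fixes the values outside the range of summation; \<open>deg_Stirling2_unique\<close> below shows that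
  the description is proper.
\<close>

definition deg_Stirling2 :: "real \<Rightarrow> nat \<Rightarrow> nat \<Rightarrow> real \<Rightarrow> real"
  where "deg_Stirling2 lambda n k x =
    (THE c. (\<forall>y. deg_falling_fact lambda (y + x) n = (\<Sum>k=0..n. c k * falling_fact y k)) \<and>
            (\<forall>k>n. c k = 0)) k"

text \<open>
  The numerator vanishes to order at least \<open>p\<close> in \<open>t\<close> and the denominator to order exactly \<open>p\<close>, so
  the quotient is exact. It has to be formed before any other factor is pulled out or in: on formal
  power series, \<open>div\<close> truncates when the division is not exact. The expansion as a composition
  is \<open>trunc_deg_Bell_gf_eq\<close> below.
\<close>

definition trunc_deg_Bell_gf :: "real \<Rightarrow> nat \<Rightarrow> real \<Rightarrow> real fps"
  where "trunc_deg_Bell_gf lambda p x =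
    (let d = deg_exp lambda 1 - 1 in
      (fps_const (fact p) * ((fps_exp 1 oo d) - (\<Sum>l<p. fps_const (1 / fact l) * d ^ l))) / d ^ p
        * deg_exp lambda x)"

definition trunc_deg_Bell :: "real \<Rightarrow> nat \<Rightarrow> nat \<Rightarrow> real \<Rightarrow> real"
  where "trunc_deg_Bell lambda p n x = fact n * fps_nth (trunc_deg_Bell_gf lambda p x) n"


lemma deg_exp_minus_one_nth_0: "fps_nth (deg_exp lambda 1 - 1) 0 = 0"
  by (simp add: deg_exp_def deg_falling_fact_def)

lemma deg_exp_minus_one_nonzero: "deg_exp lambda 1 - 1 \<noteq> 0"
proof -
  have "fps_nth (deg_exp lambda 1 - 1) 1 = 1"
    by (simp add: deg_exp_def deg_falling_fact_def)
  then show ?thesis by auto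
qed

lemma trunc_deg_Bell_gf_eq:
  "trunc_deg_Bell_gf lambda p x =
     fps_const (fact p) * (Abs_fps (\<lambda>k. 1 / fact (k + p)) oo (deg_exp lambda 1 - 1))
       * deg_exp lambda x"
proof -
  define d where "d = deg_exp lambda 1 - 1"
  define F :: "real fps" where "F = Abs_fps (\<lambda>k. 1 / fact (k + p))"
  have d0: "fps_nth d 0 = 0" and dn: "d \<noteq> 0"
    unfolding d_def by (rule deg_exp_minus_one_nth_0, rule deg_exp_minus_one_nonzero)
  have "fps_exp 1 = (\<Sum>l<p. fps_const (1 / fact l) * fps_X ^ l) + fps_X ^ p * F"
    by (rule fps_ext) (auto simp: F_def fps_sum_nth fps_X_power_mult_nth fps_X_power_nth mult_delta_right)
  then have "fps_exp 1 oo d = (\<Sum>l<p. fps_const (1 / fact l) * d ^ l) + d ^ p * (F oo d)"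
    by (simp add: fps_compose_add_distrib fps_compose_sum_distrib fps_compose_mult_distrib[OF d0]
        fps_compose_power[OF d0, symmetric] d0)
  then have "fps_const (fact p) * ((fps_exp 1 oo d) - (\<Sum>l<p. fps_const (1 / fact l) * d ^ l))
      = (fps_const (fact p) * (F oo d)) * d ^ p"
    by (simp add: algebra_simps)
  then show ?thesis
    using dn unfolding trunc_deg_Bell_gf_def Let_def d_def[symmetric] F_def[symmetric] by simp
qed

lemma falling_fact_diag: "falling_fact (real k) k \<noteq> 0"
  by (simp add: falling_fact_def)

lemma falling_fact_eq_0: "k < j \<Longrightarrow> falling_fact (real k) j = 0"
  by (auto simp: falling_fact_def)

lemma falling_fact_Suc: "falling_fact y (Suc k) = falling_fact y k * (y - real k)"
  by (simp add: falling_fact_def)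

lemma falling_fact_coeffs_unique:
  assumes "\<And>y. (\<Sum>k=0..n. c k * falling_fact y k) = (\<Sum>k=0..n. d k * falling_fact y k)"
    and "k \<le> n"
  shows "c k = d k"
  using \<open>k \<le> n\<close>
proof (induction k rule: less_induct)
  case (less k)
  have split: "(\<Sum>j=0..n. e j * falling_fact (real k) j)
      = (\<Sum>j<k. e j * falling_fact (real k) j) + e k * falling_fact (real k) k" for e
  proof -
    have "(\<Sum>j=0..n. e j * falling_fact (real k) j) = (\<Sum>j<Suc k. e j * falling_fact (real k) j)"
      using less.prems by (intro sum.mono_neutral_right) (auto simp: falling_fact_eq_0)
    then show ?thesis by simp
  qed
  have "(\<Sum>j<k. c j * falling_fact (real k) j) = (\<Sum>j<k. d j * falling_fact (real k) j)"
    using less by (intro sum.cong) auto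
  then show ?case
    using assms(1)[of "real k"] split[of c] split[of d] falling_fact_diag[of k] by simp
qed

lemma deg_Stirling2_exists:
  "\<exists>c. (\<forall>y. deg_falling_fact lambda (y + x) n = (\<Sum>k=0..n. c k * falling_fact y k)) \<and>
       (\<forall>k>n. c k = 0)"
proof (induction n)
  case 0
  show ?case
    by (rule exI[of _ "\<lambda>k. if k = 0 then 1 else 0"])
      (simp add: deg_falling_fact_def falling_fact_def)
next
  case (Suc n)
  then obtain c where c:
    "\<And>y. deg_falling_fact lambda (y + x) n = (\<Sum>k=0..n. c k * falling_fact y k)"
    "\<And>k. k > n \<Longrightarrow> c k = 0" by blast
  define c' where
    "c' k = (if k = 0 then 0 else c (k - 1)) + (real k + x - real n * lambda) * c k" for k
  have "deg_falling_fact lambda (y + x) (Suc n) = (\<Sum>k=0..Suc n. c' k * falling_fact y k)" for y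
  proof -
    have "deg_falling_fact lambda (y + x) (Suc n)
        = (\<Sum>k=0..n. c k * falling_fact y k) * (y + x - real n * lambda)"
      by (simp add: c(1)[symmetric] deg_falling_fact_def)
    also have "\<dots> = (\<Sum>k=0..n. c k * falling_fact y (Suc k))
        + (\<Sum>k=0..n. (real k + x - real n * lambda) * c k * falling_fact y k)"
      unfolding sum_distrib_right sum.distrib[symmetric]
      by (intro sum.cong) (auto simp: falling_fact_Suc algebra_simps)
    also have "(\<Sum>k=0..n. c k * falling_fact y (Suc k))
        = (\<Sum>k=0..Suc n. (if k = 0 then 0 else c (k - 1)) * falling_fact y k)"
      by (subst sum.atLeast0_atMost_Suc_shift) simp
    also have "(\<Sum>k=0..n. (real k + x - real n * lambda) * c k * falling_fact y k)
        = (\<Sum>k=0..Suc n. (real k + x - real n * lambda) * c k * falling_fact y k)"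
      by (simp add: c(2))
    finally show ?thesis
      by (simp only: c'_def sum.distrib[symmetric] distrib_right)
  qed
  moreover have "c' k = 0" if "k > Suc n" for k
    using that by (simp add: c'_def c(2))
  ultimately show ?case by blast
qed

lemma deg_Stirling2_unique:
  "\<exists>!c. (\<forall>y. deg_falling_fact lambda (y + x) n = (\<Sum>k=0..n. c k * falling_fact y k)) \<and>
        (\<forall>k>n. c k = 0)"
proof (rule ex_ex1I[OF deg_Stirling2_exists])
  fix c d :: "nat \<Rightarrow> real"
  assume
    c: "(\<forall>y. deg_falling_fact lambda (y + x) n = (\<Sum>k=0..n. c k * falling_fact y k)) \<and>
        (\<forall>k>n. c k = 0)" and
    d: "(\<forall>y. deg_falling_fact lambda (y + x) n = (\<Sum>k=0..n. d k * falling_fact y k)) \<and>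
        (\<forall>k>n. d k = 0)"
  show "c = d"
  proof
    fix k
    show "c k = d k"
    proof (cases "k \<le> n")
      case True
      have "(\<Sum>k=0..n. c k * falling_fact y k) = (\<Sum>k=0..n. d k * falling_fact y k)" for y
        using c d by metis
      then show ?thesis using True by (rule falling_fact_coeffs_unique)
    next
      case False
      then show ?thesis using c d by simp
    qed
  qed
qed

end

theory Submission
  imports Defs
begin

text \<open>
  With \<open>d = deg_exp lambda 1 - 1\<close>, the theorem follows by reading off coefficients once
  \<open>d ^ k / fact k * deg_exp lambda x\<close> is known to be the exponential generating function of
  \<open>deg_Stirling2 lambda n k x\<close> in \<open>n\<close>. The differential equation
  \<open>(1 + lambda t) E' = x E\<close> of \<open>E = deg_exp lambda x\<close> gives the coefficients of that series the
  triangular recurrence that characterises the degenerate Stirling polynomials.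
\<close>

text \<open>Coefficientwise this is \<open>(x)_{n+1} = (x - n lambda) (x)_n\<close> for the
  degenerate falling factorials, so the case \<open>lambda = 0\<close> is covered as well.\<close>

lemma deg_exp_deriv:
  "(1 + fps_const lambda * fps_X) * fps_deriv (deg_exp lambda x) = fps_const x * deg_exp lambda x"
proof (rule fps_ext)
  fix n
  have "real (Suc n) * (deg_falling_fact lambda x (Suc n) / fact (Suc n))
      = (x - real n * lambda) * (deg_falling_fact lambda x n / fact n)" for n
    by (simp add: deg_falling_fact_def divide_simps del: of_nat_Suc)
  then have step: "real (Suc n) * fps_nth (deg_exp lambda x) (Suc n)
      = (x - real n * lambda) * fps_nth (deg_exp lambda x) n" for n
    by (simp add: deg_exp_def)
  show "fps_nth ((1 + fps_const lambda * fps_X) * fps_deriv (deg_exp lambda x)) n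
      = fps_nth (fps_const x * deg_exp lambda x) n"
    using step[of n] by (cases n) (simp_all add: algebra_simps)
qed

definition deg_Stirling2_egf :: "real \<Rightarrow> nat \<Rightarrow> real \<Rightarrow> real fps"
  where "deg_Stirling2_egf lambda k x =
    fps_const (1 / fact k) * (deg_exp lambda 1 - 1) ^ k * deg_exp lambda x"

definition deg_Stirling2_coeff :: "real \<Rightarrow> nat \<Rightarrow> nat \<Rightarrow> real \<Rightarrow> real"
  where "deg_Stirling2_coeff lambda n k x = fact n * fps_nth (deg_Stirling2_egf lambda k x) n"

text \<open>Multiplying \<open>fps_deriv\<close> by \<open>1 + lambda t\<close> gives a derivation
  that sends \<open>d\<close> to \<open>1 + d\<close> and \<open>E\<close> to \<open>x E\<close>.
  Hence \<open>d^k / k!\<close> goes to \<open>d^(k-1) / (k-1)! + k d^k / k!\<close>, and the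
  product rule adds \<open>x\<close>.\<close>

lemma deg_Stirling2_egf_deriv:
  "(1 + fps_const lambda * fps_X) * fps_deriv (deg_Stirling2_egf lambda k x) =
     (if k = 0 then 0 else deg_Stirling2_egf lambda (k - 1) x)
     + fps_const (real k + x) * deg_Stirling2_egf lambda k x"
proof -
  define d where "d = deg_exp lambda 1 - 1"
  define E where "E = deg_exp lambda x"
  define A where "A = 1 + fps_const lambda * fps_X"
  have E: "A * fps_deriv E = fps_const x * E"
    unfolding A_def E_def by (rule deg_exp_deriv)
  have d: "A * fps_deriv d = 1 + d"
    using deg_exp_deriv[of lambda 1] by (simp add: d_def A_def)
  show ?thesis
  proof (cases k)
    case 0
    then show ?thesis
      using E by (simp add: deg_Stirling2_egf_def A_def E_def)
  next
    case (Suc j)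
    define q :: "real fps" where "q = fps_const (1 / fact k)"
    have q: "q * fps_const (real k) = fps_const (1 / fact j)"
      using Suc by (simp add: q_def fps_const_mult del: of_nat_Suc)
    have "fps_deriv (d ^ k) = fps_const (real k) * fps_deriv d * d ^ j"
      using Suc by (simp only: fps_deriv_power) simp
    then have "A * fps_deriv (q * d ^ k * E)
        = q * (fps_const (real k) * (A * fps_deriv d) * d ^ j * E + d ^ k * (A * fps_deriv E))"
      by (simp add: q_def algebra_simps)
    also have "\<dots> = (q * fps_const (real k)) * d ^ j * E
        + (fps_const (real k) + fps_const x) * (q * d ^ k * E)"
      unfolding d E Suc power_Suc by (simp only: algebra_simps mult_1_left)
    also have "\<dots> = deg_Stirling2_egf lambda j x
        + fps_const (real k + x) * deg_Stirling2_egf lambda k x"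
      unfolding q by (simp add: deg_Stirling2_egf_def d_def E_def q_def)
    finally show ?thesis
      using Suc by (simp only: deg_Stirling2_egf_def A_def d_def E_def q_def) simp
  qed
qed

lemma deg_Stirling2_coeff_Suc:
  "deg_Stirling2_coeff lambda (Suc n) k x =
     (if k = 0 then 0 else deg_Stirling2_coeff lambda n (k - 1) x)
     + (real k + x - real n * lambda) * deg_Stirling2_coeff lambda n k x"
proof -
  have "real (Suc n) * fps_nth (deg_Stirling2_egf lambda k x) (Suc n)
      + lambda * real n * fps_nth (deg_Stirling2_egf lambda k x) n
      = (if k = 0 then 0 else fps_nth (deg_Stirling2_egf lambda (k - 1) x) n)
      + (real k + x) * fps_nth (deg_Stirling2_egf lambda k x) n"
    using arg_cong[OF deg_Stirling2_egf_deriv[of lambda k x], of "\<lambda>f. fps_nth f n"]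
    \<comment> \<open>The term \<open>lambda t f'\<close> contributes \<open>lambda n f_n\<close>;
      at \<open>n = 0\<close> it has no preceding coefficient to shift from.\<close>
    by (cases n) (auto simp: algebra_simps split: if_splits)
  then have "real (Suc n) * fps_nth (deg_Stirling2_egf lambda k x) (Suc n)
      = (if k = 0 then 0 else fps_nth (deg_Stirling2_egf lambda (k - 1) x) n)
      + (real k + x - real n * lambda) * fps_nth (deg_Stirling2_egf lambda k x) n"
    by (simp add: algebra_simps)
  from arg_cong[OF this, of "\<lambda>a. fact n * a"] show ?thesis
    by (simp add: deg_Stirling2_coeff_def algebra_simps del: of_nat_Suc split: if_splits)
qed

lemma deg_Stirling2_coeff_0: "deg_Stirling2_coeff lambda 0 k x = (if k = 0 then 1 else 0)"
  by (simp add: deg_Stirling2_coeff_def deg_Stirling2_egf_def fps_nth_power_0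
      deg_exp_minus_one_nth_0 del: fps_sub_nth) (simp add: deg_exp_def deg_falling_fact_def)

lemma deg_Stirling2_coeff_eq_0: "n < k \<Longrightarrow> deg_Stirling2_coeff lambda n k x = 0"
  by (induction n arbitrary: k) (auto simp: deg_Stirling2_coeff_0 deg_Stirling2_coeff_Suc)

text \<open>The recurrence matches multiplication by the next factor
  \<open>y + x - n lambda = (y - k) + (k + x - n lambda)\<close>, whose first part raises
  \<open>falling_fact y k\<close> to index \<open>k + 1\<close>.\<close>

lemma deg_falling_fact_add_eq_sum:
  "deg_falling_fact lambda (y + x) n
     = (\<Sum>k=0..n. deg_Stirling2_coeff lambda n k x * falling_fact y k)"
proof (induction n)
  case 0
  show ?case by (simp add: deg_falling_fact_def falling_fact_def deg_Stirling2_coeff_0)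
next
  case (Suc n)
  define c where "c k = deg_Stirling2_coeff lambda n k x" for k
  have "deg_falling_fact lambda (y + x) (Suc n)
      = (\<Sum>k=0..n. c k * falling_fact y k) * (y + x - real n * lambda)"
    by (simp add: c_def Suc.IH[symmetric] deg_falling_fact_def)
  also have "\<dots> = (\<Sum>k=0..n. c k * falling_fact y (Suc k))
      + (\<Sum>k=0..n. (real k + x - real n * lambda) * c k * falling_fact y k)"
    unfolding sum_distrib_right sum.distrib[symmetric]
    by (intro sum.cong) (auto simp: falling_fact_Suc algebra_simps)
  also have "(\<Sum>k=0..n. c k * falling_fact y (Suc k))
      = (\<Sum>k=0..Suc n. (if k = 0 then 0 else c (k - 1)) * falling_fact y k)"
    by (subst sum.atLeast0_atMost_Suc_shift) simp
  \<comment> \<open>The extra summand vanishes because \<open>c (Suc n) = 0\<close>.\<close>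
  also have "(\<Sum>k=0..n. (real k + x - real n * lambda) * c k * falling_fact y k)
      = (\<Sum>k=0..Suc n. (real k + x - real n * lambda) * c k * falling_fact y k)"
    by (simp add: c_def deg_Stirling2_coeff_eq_0)
  finally show ?case
    by (simp only: c_def deg_Stirling2_coeff_Suc sum.distrib[symmetric] distrib_right)
qed

lemma deg_Stirling2_eq_coeff: "deg_Stirling2 lambda n k x = deg_Stirling2_coeff lambda n k x"
proof -
  have "(THE c. (\<forall>y. deg_falling_fact lambda (y + x) n = (\<Sum>k=0..n. c k * falling_fact y k)) \<and>
      (\<forall>k>n. c k = 0)) = (\<lambda>k. deg_Stirling2_coeff lambda n k x)"
    by (rule the1_equality[OF deg_Stirling2_unique])
      (simp add: deg_falling_fact_add_eq_sum deg_Stirling2_coeff_eq_0)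
  then show ?thesis by (simp add: deg_Stirling2_def)
qed

text \<open>Since \<open>d ^ k\<close> starts at order \<open>k\<close> or later, every inner sum
  can be extended to the common bound \<open>n\<close>; the two finite sums may then be
  swapped.\<close>

lemma fps_compose_mult_nth:
  fixes F d E :: "'a :: comm_ring_1 fps"
  assumes "fps_nth d 0 = 0"
  shows "fps_nth ((F oo d) * E) n = (\<Sum>k=0..n. fps_nth F k * fps_nth (d ^ k * E) n)"
proof -
  have "fps_nth (F oo d) i = (\<Sum>k=0..n. fps_nth F k * fps_nth (d ^ k) i)" if "i \<le> n" for i
    unfolding fps_compose_nth using that
    by (intro sum.mono_neutral_left) (auto simp: startsby_zero_power_prefix[OF assms])
  then have "fps_nth ((F oo d) * E) n
      = (\<Sum>i=0..n. \<Sum>k=0..n. fps_nth F k * (fps_nth (d ^ k) i * fps_nth E (n - i)))"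
    by (simp add: fps_mult_nth sum_distrib_right mult.assoc)
  also have "\<dots> = (\<Sum>k=0..n. fps_nth F k * fps_nth (d ^ k * E) n)"
    by (subst sum.swap) (simp add: fps_mult_nth sum_distrib_left)
  finally show ?thesis .
qed

theorem theorem14:
  fixes lambda x :: real and n p :: nat
  shows "trunc_deg_Bell lambda p n x =
    (\<Sum>k=0..n. 1 / real ((k + p) choose p) * deg_Stirling2 lambda n k x)"
proof -
  have "trunc_deg_Bell lambda p n x = (\<Sum>k=0..n. fact n * (fact p * (1 / fact (k + p) *
      fps_nth ((deg_exp lambda 1 - 1) ^ k * deg_exp lambda x) n)))"
    by (simp add: trunc_deg_Bell_def trunc_deg_Bell_gf_eq mult.assoc
        fps_compose_mult_nth[OF deg_exp_minus_one_nth_0] sum_distrib_left)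
  \<comment> \<open>The weight \<open>p! / (k+p)!\<close> is the inverse binomial coefficient times
    \<open>1 / k!\<close>, and this \<open>1 / k!\<close> is the one inside
    \<open>deg_Stirling2_egf\<close>.\<close>
  also have "\<dots> = (\<Sum>k=0..n. 1 / real ((k + p) choose p) * deg_Stirling2 lambda n k x)"
    by (intro sum.cong)
      (simp_all add: deg_Stirling2_eq_coeff deg_Stirling2_coeff_def deg_Stirling2_egf_def
        binomial_fact mult.assoc)
  finally show ?thesis .
qed

end
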